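(* Let $A=B+\operatorname{tril}(UV^\top,-1)+\operatorname{triu}(WS^\top,1)\in \mathrm{BPS}_{(r,p),(\ell,m)}^{n\times n}$ and let $F_0,F_1,\dots,F_{n-1}$ be the partial factor matrices of the Householder QR factorization of $A$. For $1\le k\le n-1$, suppose $F_{k-1}\in \mathrm{BPSF}_{k-1}(A)$. Then $F_k\in \mathrm{BPSF}_k(A)$.
   Context: Notation: $M[a:b,c:d]$ is the submatrix of $M$ with rows $a,\dots,b$ and columns $c,\dots,d$; ":" alone means all indices. $\operatorname{tril}(M,-1)$ is the strictly lower triangular part of $M$ and $\operatorname{triu}(M,1)$ its strictly upper triangular part (other entries set to zero). $\mathrm{BM}_{(\ell,m)}^{n\times n}$ is the set of $B=(b_{kj})\in\mathbb{R}^{n\times n}$ with $b_{kj}=0$ whenever $k-j>\ell$ or $j-k>m$. $A\in \mathrm{BPS}_{(r,p),(\ell,m)}^{n\times n}$ if $A=B+\operatorname{tril}(UV^\top,-1)+\operatorname{triu}(WS^\top,1)$ with $U,V\in\mathbb{R}^{n\times r}$, $W,S\in\mathbb{R}^{n\times p}$, $B\in \mathrm{BM}_{(\ell,m)}^{n\times n}$; the representation $(B,U,V,W,S)$ is fixed. The principal submatrix $A[k:n,k:n]$ is regarded as a BPS matrix with representation $B[k:n,k:n]$, $U[k:n,:]$, $V[k:n,:]$, $W[k:n,:]$, $S[k:n,:]$ and the same $r,p,\ell,m$. Padded matrices: $\mathcal{S}_{a\times b}^{c\times d}$ is the set of $M\in\mathbb{R}^{c\times d}$ with $M[i,j]=0$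 unless $i\le a$ and $j\le b$. Perturbation space: for $A=B+\operatorname{tril}(UV^\top,-1)+\operatorname{triu}(WS^\top,1)\in \mathrm{BPS}_{(r,p),(\ell,m)}^{n\times n}$, $$\mathcal{P}(A)=\{UJS^\top+UKU^\top A+UE+XS^\top+YU^\top A+Z:\ J\in\mathbb{R}^{r\times p},K\in\mathbb{R}^{r\times r},E\in\mathcal{S}_{r\times(\ell+m)}^{r\times n},X\in\mathcal{S}_{\ell\times p}^{n\times p},Y\in\mathcal{S}_{\ell\times r}^{n\times r},Z\in\mathcal{S}_{\ell\times(\ell+m)}^{n\times n}\}.$$ Householder QR: set $A^{(0)}=A$. For $k=1,\dots,n-1$ let $x=A^{(k-1)}[k:n,k]$ and $\alpha_k=\operatorname{sign}(x_1)\,\big|x_1+\operatorname{sign}(x_1)\|x\|_2\big|$. Let $\mathbf{y}_k\in\mathbb{R}^n$ have entries $0$ in positions $1,\dots,k-1$, entry $1$ in position $k$, and entry $x_{i-k+1}/\alpha_k$ in positions $i=k+1,\dots,n$. Put $\tau_k=2\|\mathbf{y}_k\|_2^{-2}$ and $A^{(k)}=(I-\tau_k\mathbf{y}_k\mathbf{y}_k^\top)A^{(k-1)}$. Partial factor matrices: for $0\le k\le n-1$, $F_k[i,j]=\mathbf{y}_j[i]$ if $j\le k$ and $i>j$, and $F_k[i,j]=A^{(k)}[i,j]$ otherwise. In particular $F_0=A$. The class $\mathrm{BPSF}_k(A)$: let $\tilde S=[\,S\ \ A^\top U\,]\in\mathbb{R}^{n\times(r+p)}$. A matrix $F_k\in\mathbb{R}^{n\times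 n}$ is in $\mathrm{BPSF}_k(A)$ if there exist $B_k\in \mathrm{BM}_{(\ell,\ell+m)}^{n\times n}$, $V_k\in\mathbb{R}^{n\times r}$, $W_k\in\mathbb{R}^{n\times(r+p)}$ such that, with $G_k=B_k+\operatorname{tril}(UV_k^\top,-1)+\operatorname{triu}(W_k\tilde S^\top,1)$, one has $F_k[:,1:k]=G_k[:,1:k]$ and $F_k[1:k,:]=G_k[1:k,:]$, and moreover $F_k[k+1:n,k+1:n]=A[k+1:n,k+1:n]+P_k$ for some $P_k\in\mathcal{P}(A[k+1:n,k+1:n])$. *)

theory Defs
  imports Complex_Main "Jordan_Normal_Form.Matrix"
begin

text \<open>
  Matrices are those of Jordan\_Normal\_Form, hence indexed from 0; the mathematical entry
  \<open>M[i,j]\<close> (indexed from 1) is \<open>M $$ (i - 1, j - 1)\<close>.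
\<close>

text \<open>\<open>block M a b c d\<close> is \<open>M[a+1:b, c+1:d]\<close> in 1-based inclusive notation.\<close>

definition block :: "real mat \<Rightarrow> nat \<Rightarrow> nat \<Rightarrow> nat \<Rightarrow> nat \<Rightarrow> real mat" where
  "block M a b c d = mat (b - a) (d - c) (\<lambda>(i, j). M $$ (a + i, c + j))"

definition hcat :: "real mat \<Rightarrow> real mat \<Rightarrow> real mat" where
  "hcat M N = mat (dim_row M) (dim_col M + dim_col N)
     (\<lambda>(i, j). if j < dim_col M then M $$ (i, j) else N $$ (i, j - dim_col M))"

definition strict_tril :: "real mat \<Rightarrow> real mat" where
  "strict_tril M = mat (dim_row M) (dim_col M) (\<lambda>(i, j). if j < i then M $$ (i, j) else 0)"

definition strict_triu :: "real mat \<Rightarrow> real mat" where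
  "strict_triu M = mat (dim_row M) (dim_col M) (\<lambda>(i, j). if i < j then M $$ (i, j) else 0)"

definition band_mats :: "nat \<Rightarrow> nat \<Rightarrow> nat \<Rightarrow> real mat set" where
  "band_mats n l m = {M \<in> carrier_mat n n.
     \<forall>i<n. \<forall>j<n. i > j + l \<or> j > i + m \<longrightarrow> M $$ (i, j) = 0}"

definition bps_rep ::
  "nat \<Rightarrow> nat \<Rightarrow> nat \<Rightarrow> nat \<Rightarrow> nat \<Rightarrow> real mat
    \<Rightarrow> real mat \<Rightarrow> real mat \<Rightarrow> real mat \<Rightarrow> real mat \<Rightarrow> real mat \<Rightarrow> bool" where
  "bps_rep n r p l m A B U V W S \<longleftrightarrow>
     B \<in> band_mats n l m \<and>
     U \<in> carrier_mat n r \<and> V \<in> carrier_mat n r \<and>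
     W \<in> carrier_mat n p \<and> S \<in> carrier_mat n p \<and>
     A = B + strict_tril (U * V\<^sup>T) + strict_triu (W * S\<^sup>T)"

text \<open>\<open>padded_mats a b c d\<close>: the \<open>c \<times> d\<close> matrices supported on the leading \<open>a \<times> b\<close> corner.
  There is no requirement \<open>a \<le> c\<close> or \<open>b \<le> d\<close>.\<close>

definition padded_mats :: "nat \<Rightarrow> nat \<Rightarrow> nat \<Rightarrow> nat \<Rightarrow> real mat set" where
  "padded_mats a b c d = {M \<in> carrier_mat c d.
     \<forall>i<c. \<forall>j<d. \<not> (i < a \<and> j < b) \<longrightarrow> M $$ (i, j) = 0}"

text \<open>The perturbation space of a BPS matrix \<open>A\<close> with fixed representation \<open>(B, U, V, W, S)\<close>;
  besides \<open>A\<close> itself only \<open>U\<close> and \<open>S\<close> enter.\<close>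

definition pert_space ::
  "nat \<Rightarrow> nat \<Rightarrow> nat \<Rightarrow> nat \<Rightarrow> nat \<Rightarrow> real mat \<Rightarrow> real mat \<Rightarrow> real mat \<Rightarrow> real mat set" where
  "pert_space n r p l m U S A =
     {U * J * S\<^sup>T + U * K * U\<^sup>T * A + U * E + X * S\<^sup>T + Y * U\<^sup>T * A + Z | J K E X Y Z.
        J \<in> carrier_mat r p \<and> K \<in> carrier_mat r r \<and>
        E \<in> padded_mats r (l + m) r n \<and> X \<in> padded_mats l p n p \<and>
        Y \<in> padded_mats l r n r \<and> Z \<in> padded_mats l (l + m) n n}"

text \<open>The sign convention of Householder reflections has value 1 at 0, unlike \<open>sgn\<close>:
  otherwise a column with vanishing pivot entry would not be reduced.\<close>

definition hh_sign :: "real \<Rightarrow> real" where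
  "hh_sign t = (if t < 0 then - 1 else 1)"

definition norm2 :: "real vec \<Rightarrow> real" where
  "norm2 x = sqrt (x \<bullet> x)"

definition hh_alpha :: "real vec \<Rightarrow> real" where
  "hh_alpha x = hh_sign (x $ 0) * \<bar>x $ 0 + hh_sign (x $ 0) * norm2 x\<bar>"

text \<open>\<open>hh_vec q M\<close> is the reflection vector with 0-based pivot position \<open>q\<close>, so that
  \<open>y\<^sub>k = hh_vec (k - 1) A\<^sup>(\<^sup>k\<^sup>-\<^sup>1\<^sup>)\<close>. If \<open>hh_alpha x = 0\<close>, that is \<open>x = 0\<close>, then division by zero
  yields the unit vector at position \<open>q\<close>.\<close>

definition hh_vec :: "nat \<Rightarrow> real mat \<Rightarrow> real vec" where
  "hh_vec q M =
     (let n = dim_row M;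
          x = vec (n - q) (\<lambda>i. M $$ (q + i, q))
      in vec n (\<lambda>i. if i < q then 0 else if i = q then 1 else x $ (i - q) / hh_alpha x))"

definition hh_tau :: "real vec \<Rightarrow> real" where
  "hh_tau y = 2 / (norm2 y)\<^sup>2"

definition outer :: "real vec \<Rightarrow> real vec \<Rightarrow> real mat" where
  "outer x y = mat (dim_vec x) (dim_vec y) (\<lambda>(i, j). x $ i * y $ j)"

primrec qr_iter :: "real mat \<Rightarrow> nat \<Rightarrow> real mat" where
  "qr_iter A 0 = A"
| "qr_iter A (Suc q) =
     (let M = qr_iter A q; y = hh_vec q M
      in (1\<^sub>m (dim_row A) - hh_tau y \<cdot>\<^sub>m outer y y) * M)"

text \<open>The 0-based column \<open>j\<close> holds \<open>y\<^sub>j\<^sub>+\<^sub>1\<close>, which is formed from \<open>qr_iter A j\<close>.\<close>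

definition partial_factor :: "real mat \<Rightarrow> nat \<Rightarrow> real mat" where
  "partial_factor A k = mat (dim_row A) (dim_col A)
     (\<lambda>(i, j). if j < k \<and> i > j then hh_vec j (qr_iter A j) $ i else qr_iter A k $$ (i, j))"

definition bpsf ::
  "nat \<Rightarrow> nat \<Rightarrow> nat \<Rightarrow> nat \<Rightarrow> nat \<Rightarrow> real mat \<Rightarrow> real mat \<Rightarrow> real mat \<Rightarrow> nat \<Rightarrow> real mat set" where
  "bpsf n r p l m U S A k = {F \<in> carrier_mat n n.
     (\<exists>Bk \<in> band_mats n l (l + m). \<exists>Vk \<in> carrier_mat n r. \<exists>Wk \<in> carrier_mat n (r + p).
        let G = Bk + strict_tril (U * Vk\<^sup>T) + strict_triu (Wk * (hcat S (A\<^sup>T * U))\<^sup>T)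
        in block F 0 n 0 k = block G 0 n 0 k \<and> block F 0 k 0 n = block G 0 k 0 n) \<and>
     (\<exists>P \<in> pert_space (n - k) r p l m (block U k n 0 r) (block S k n 0 p) (block A k n k n).
        block F k n k n = block A k n k n + P)}"

text \<open>The data used for the trailing block in \<open>bpsf\<close> come from the restricted representation.\<close>

lemma bps_rep_trailing:
  assumes "bps_rep n r p l m A B U V W S" and "k \<le> n"
  shows "bps_rep (n - k) r p l m (block A k n k n)
    (block B k n k n) (block U k n 0 r) (block V k n 0 r) (block W k n 0 p) (block S k n 0 p)"
  using assms
  unfolding bps_rep_def band_mats_def
  by (auto simp: block_def strict_tril_def strict_triu_def scalar_prod_def intro!: eq_matI)

lemma partial_factor_0: "partial_factor A 0 = A"
  by (auto simp: partial_factor_def)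

end

theory Submission
  imports Defs
begin

text \<open>
  Call a row \<^emph>\<open>tame from \<open>c\<close> on\<close> if its entries in columns \<open>j \<ge> c\<close> (counted from 0) agree with a
  combination of the columns of \<open>[S, A\<^sup>T U]\<close>. Since band and padded parts are arbitrary where they
  may be nonzero, \<open>F \<in> BPSF\<^sub>k(A)\<close> only says: in the first \<open>k\<close> columns the part below the band lies
  in the column space of \<open>U\<close>; each row \<open>i < k\<close> is tame from \<open>i + l + m + 1\<close> on; the rows
  \<open>k, \<dots>, k + l - 1\<close> are tame from \<open>k + l + m\<close> on; and on the remaining rows of the trailing block
  \<open>F - A = U \<phi>\<close> with the rows of \<open>\<phi>\<close> tame from \<open>k + l + m\<close> on.

  One Householder step with pivot \<open>q\<close> replaces each row \<open>F\<^sub>i\<close> by \<open>F\<^sub>i - \<tau> y\<^sub>i z\<close> with \<open>z = y\<^sup>T F\<close>.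
  Below row \<open>q + l\<close> the vector \<open>y\<close> equals \<open>U v\<close> for some \<open>v\<close>, so \<open>z\<close> is \<open>v\<^sup>T U\<^sup>T A\<close> plus a
  combination of rows that are tame from \<open>q + l + m + 1\<close> on. Hence \<open>z\<close> is tame from there on, and
  the step sends \<open>\<phi>\<close> to \<open>\<phi> - \<tau> v z\<close>.
\<close>

section \<open>Rows whose tails lie in the span of fixed columns\<close>

text \<open>Rows are functions of a column index rather than vectors, so a row of a trailing block
  becomes a row of the whole matrix by a shift of its argument. \<open>C\<close> is a parameter
  because the product \<open>A\<^sup>T * U\<close> is needed both for \<open>A\<close> and for its
  trailing blocks.\<close>

definition tail_span :: "real mat \<Rightarrow> real mat \<Rightarrow> nat \<Rightarrow> (nat \<Rightarrow> real) \<Rightarrow> bool" where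
  "tail_span S C c f \<longleftrightarrow> (\<exists>g h. \<forall>j. c \<le> j \<longrightarrow> j < dim_row S \<longrightarrow>
     f j = (\<Sum>t<dim_col S. g t * S $$ (j, t)) + (\<Sum>u<dim_col C. h u * C $$ (j, u)))"

lemma tail_span_mono:
  assumes "tail_span S C c f" "c \<le> d" shows "tail_span S C d f"
  using assms unfolding tail_span_def by (meson le_trans)

lemma tail_span_cong:
  assumes "tail_span S C c f" "\<And>j. c \<le> j \<Longrightarrow> j < dim_row S \<Longrightarrow> g j = f j"
  shows "tail_span S C c g"
  using assms unfolding tail_span_def by metis

lemma tail_span_zero: "tail_span S C c (\<lambda>j. 0)"
  unfolding tail_span_def by (intro exI[of _ "\<lambda>_. 0"]) simp

lemma tail_span_add:
  assumes "tail_span S C c f" "tail_span S C c g"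
  shows "tail_span S C c (\<lambda>j. f j + g j)"
proof -
  from assms obtain a b a' b' where
    "\<forall>j. c \<le> j \<longrightarrow> j < dim_row S \<longrightarrow>
     f j = (\<Sum>t<dim_col S. a t * S $$ (j, t)) + (\<Sum>u<dim_col C. b u * C $$ (j, u))"
    "\<forall>j. c \<le> j \<longrightarrow> j < dim_row S \<longrightarrow>
     g j = (\<Sum>t<dim_col S. a' t * S $$ (j, t)) + (\<Sum>u<dim_col C. b' u * C $$ (j, u))"
    unfolding tail_span_def by blast
  then show ?thesis unfolding tail_span_def
    by (intro exI[of _ "\<lambda>t. a t + a' t"] exI[of _ "\<lambda>t. b t + b' t"])
      (simp add: algebra_simps sum.distrib)
qed

lemma tail_span_scale:
  assumes "tail_span S C c f"
  shows "tail_span S C c (\<lambda>j. x * f j)"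
proof -
  from assms obtain a b where
    "\<forall>j. c \<le> j \<longrightarrow> j < dim_row S \<longrightarrow>
     f j = (\<Sum>t<dim_col S. a t * S $$ (j, t)) + (\<Sum>u<dim_col C. b u * C $$ (j, u))"
    unfolding tail_span_def by blast
  then show ?thesis unfolding tail_span_def
    by (intro exI[of _ "\<lambda>t. x * a t"] exI[of _ "\<lambda>t. x * b t"])
      (simp add: algebra_simps sum_distrib_left)
qed

lemma tail_span_diff:
  assumes "tail_span S C c f" "tail_span S C c g"
  shows "tail_span S C c (\<lambda>j. f j - g j)"
  using tail_span_add[OF assms(1) tail_span_scale[OF assms(2), of "-1"]] by simp

lemma tail_span_sum:
  assumes "\<And>i. i \<in> I \<Longrightarrow> tail_span S C c (f i)"
  shows "tail_span S C c (\<lambda>j. \<Sum>i\<in>I. f i j)"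
  using assms
  by (induction I rule: infinite_finite_induct) (auto intro: tail_span_zero tail_span_add)

lemma tail_span_left:
  "tail_span S C c (\<lambda>j. \<Sum>t<dim_col S. g t * S $$ (j, t))"
  unfolding tail_span_def by (intro exI[of _ g] exI[of _ "\<lambda>_. 0"]) simp

lemma tail_span_right:
  assumes "u < dim_col C"
  shows "tail_span S C c (\<lambda>j. C $$ (j, u))"
  unfolding tail_span_def using assms
  by (intro exI[of _ "\<lambda>_. 0"] exI[of _ "\<lambda>v. if v = u then 1 else 0"])
    (simp add: if_distrib[of "\<lambda>x. x * _"] cong: if_cong)

section \<open>Entrywise forms of the perturbation space and of the leading blocks\<close>

lemma index_mult_mat_sum:
  assumes "M \<in> carrier_mat a b" "N \<in> carrier_mat b c" "i < a" "j < c"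
  shows "(M * N) $$ (i, j) = (\<Sum>t<b. M $$ (i, t) * N $$ (t, j))"
  using assms by (auto simp: scalar_prod_def atLeast0LessThan)

text \<open>\<open>E\<close> and \<open>Z\<close> absorb the first \<open>l + m\<close> columns, so rows need only be controlled beyond them;
  \<open>\<phi>\<close> plays the role of \<open>J S\<^sup>T + K U\<^sup>T A + E\<close>.\<close>

lemma pert_space_iff:
  assumes U: "U \<in> carrier_mat n r" and S: "S \<in> carrier_mat n p" and A: "A \<in> carrier_mat n n"
    and C_eq: "C = A\<^sup>T * U"
  shows "P \<in> pert_space n r p l m U S A \<longleftrightarrow> P \<in> carrier_mat n n \<and>
    (\<exists>\<phi>. (\<forall>s<r. tail_span S C (l + m) (\<phi> s)) \<and>
         (\<forall>i<n. i < l \<longrightarrow> tail_span S C (l + m) (\<lambda>j. P $$ (i, j))) \<and>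
         (\<forall>i<n. \<forall>j<n. l \<le> i \<longrightarrow> P $$ (i, j) = (\<Sum>s<r. U $$ (i, s) * \<phi> s j)))"
    (is "?L \<longleftrightarrow> ?R")
proof -
  let ?T = "tail_span S C (l + m)"
  have C: "C \<in> carrier_mat n r" using U A C_eq by simp
  have UA: "U\<^sup>T * A = C\<^sup>T" using U A C_eq by (simp add: transpose_mult)
  have comb: "(X * S\<^sup>T + Y * C\<^sup>T + Z) $$ (i, j)
      = (\<Sum>t<p. X $$ (i, t) * S $$ (j, t)) + (\<Sum>u<r. Y $$ (i, u) * C $$ (j, u)) + Z $$ (i, j)"
    if "X \<in> carrier_mat a p" "Y \<in> carrier_mat a r" "Z \<in> carrier_mat a n" "i < a" "j < n"
    for X Y Z a i j
  proof -
    have "(X * S\<^sup>T) $$ (i, j) = (\<Sum>t<p. X $$ (i, t) * S $$ (j, t))"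
      using that S by (subst index_mult_mat_sum[of _ a p _ n]) auto
    moreover have "(Y * C\<^sup>T) $$ (i, j) = (\<Sum>u<r. Y $$ (i, u) * C $$ (j, u))"
      using that C by (subst index_mult_mat_sum[of _ a r _ n]) (auto intro!: sum.cong)
    ultimately show ?thesis using that S C by simp
  qed
  \<comment> \<open>The terms with left factor \<open>U\<close> collect into U \<phi>; the other
    three form a correction, which the padding of \<open>X\<close>, \<open>Y\<close>,
    \<open>Z\<close> will confine to the first \<open>l\<close> rows.\<close>
  have regroup: "U * J * S\<^sup>T + U * K * U\<^sup>T * A + U * E + X * S\<^sup>T + Y * U\<^sup>T * A + Z
      = U * (J * S\<^sup>T + K * C\<^sup>T + E) + (X * S\<^sup>T + Y * C\<^sup>T + Z)"
    if "J \<in> carrier_mat r p" "K \<in> carrier_mat r r" "E \<in> carrier_mat r n"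
      "X \<in> carrier_mat n p" "Y \<in> carrier_mat n r" "Z \<in> carrier_mat n n" for J K E X Y Z
  proof -
    have "U * K * U\<^sup>T * A = U * (K * C\<^sup>T)"
      using that U A C UA assoc_mult_mat[of "U * K" n r "U\<^sup>T" n A n]
        assoc_mult_mat[of U n r K r "C\<^sup>T" n] by simp
    moreover have "Y * U\<^sup>T * A = Y * C\<^sup>T"
      using that U A UA assoc_mult_mat[of Y n r "U\<^sup>T" n A n] by simp
    moreover have "U * J * S\<^sup>T = U * (J * S\<^sup>T)"
      using that U S assoc_mult_mat[of U n r J p "S\<^sup>T" n] by simp
    moreover have "U * (J * S\<^sup>T + K * C\<^sup>T + E) = U * (J * S\<^sup>T) + U * (K * C\<^sup>T) + U * E"
    proof -
      have c: "J * S\<^sup>T \<in> carrier_mat r n" "K * C\<^sup>T \<in> carrier_mat r n"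
        using that S C by auto
      show ?thesis
        by (simp only: mult_add_distrib_mat[OF U add_carrier_mat[OF c(2)] that(3)]
            mult_add_distrib_mat[OF U c])
    qed
    ultimately show ?thesis
      using that U S C by (intro eq_matI) (auto simp del: index_mult_mat(1))
  qed
  have ind: "(U * M + N) $$ (i, j) = (\<Sum>s<r. U $$ (i, s) * M $$ (s, j)) + N $$ (i, j)"
    if "M \<in> carrier_mat r n" "N \<in> carrier_mat n n" "i < n" "j < n" for M N i j
    using that U index_mult_mat_sum[OF U that(1) that(3,4)] by simp
  show ?thesis
  proof
    assume ?L
    then obtain J K E X Y Z where h: "J \<in> carrier_mat r p" "K \<in> carrier_mat r r"
        "E \<in> padded_mats r (l + m) r n" "X \<in> padded_mats l p n p"
        "Y \<in> padded_mats l r n r" "Z \<in> padded_mats l (l + m) n n"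
      and P: "P = U * J * S\<^sup>T + U * K * U\<^sup>T * A + U * E + X * S\<^sup>T + Y * U\<^sup>T * A + Z"
      unfolding pert_space_def by blast
    have c: "E \<in> carrier_mat r n" "X \<in> carrier_mat n p" "Y \<in> carrier_mat n r" "Z \<in> carrier_mat n n"
      using h by (auto simp: padded_mats_def)
    let ?M = "J * S\<^sup>T + K * C\<^sup>T + E" and ?N = "X * S\<^sup>T + Y * C\<^sup>T + Z"
    have M: "?M \<in> carrier_mat r n" and N: "?N \<in> carrier_mat n n"
      using h c S C by auto
    have P': "P = U * ?M + ?N" using P regroup[OF h(1,2) c] by simp
    have tM: "?T (\<lambda>j. ?M $$ (s, j))" if "s < r" for s
      unfolding tail_span_def using comb[OF h(1,2) c(1) that] h(3) S C that
      by (intro exI[of _ "\<lambda>t. J $$ (s, t)"] exI[of _ "\<lambda>u. K $$ (s, u)"]) (auto simp: padded_mats_def)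
    have tN: "?T (\<lambda>j. ?N $$ (i, j))" if "i < n" for i
      unfolding tail_span_def using comb[OF c(2,3,4) that] h(6) S C that
      by (intro exI[of _ "\<lambda>t. X $$ (i, t)"] exI[of _ "\<lambda>u. Y $$ (i, u)"]) (auto simp: padded_mats_def)
    have N0: "?N $$ (i, j) = 0" if "i < n" "j < n" "l \<le> i" for i j
      using comb[OF c(2,3,4) that(1,2)] h that by (auto simp: padded_mats_def)
    have ent: "P $$ (i, j) = (\<Sum>s<r. U $$ (i, s) * ?M $$ (s, j)) + ?N $$ (i, j)"
      if "i < n" "j < n" for i j unfolding P' by (rule ind[OF M N that])
    have tP: "?T (\<lambda>j. P $$ (i, j))" if "i < n" for i
    proof (rule tail_span_cong)
      show "?T (\<lambda>j. (\<Sum>s<r. U $$ (i, s) * ?M $$ (s, j)) + ?N $$ (i, j))"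
        by (intro tail_span_add tail_span_sum tail_span_scale tM tN that) simp
    qed (use ent that S in simp)
    have "P \<in> carrier_mat n n" unfolding P' using U M N by simp
    moreover have "\<forall>s<r. ?T ((\<lambda>s j. ?M $$ (s, j)) s)" using tM by simp
    ultimately show ?R using tP ent N0 by (intro conjI exI[of _ "\<lambda>s j. ?M $$ (s, j)"]) auto
  next
    assume ?R
    then obtain \<phi> where P: "P \<in> carrier_mat n n" and t\<phi>: "\<And>s. s < r \<Longrightarrow> ?T (\<phi> s)"
      and tP: "\<And>i. i < n \<Longrightarrow> i < l \<Longrightarrow> ?T (\<lambda>j. P $$ (i, j))"
      and low: "\<And>i j. i < n \<Longrightarrow> j < n \<Longrightarrow> l \<le> i \<Longrightarrow> P $$ (i, j) = (\<Sum>s<r. U $$ (i, s) * \<phi> s j)"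
      by blast
    \<comment> \<open>On the first \<open>l\<close> rows \<open>P\<close> is tame but need not equal
      U \<phi>; \<psi> is the defect that \<open>X\<close>, \<open>Y\<close>, \<open>Z\<close> have
      to produce there.\<close>
    define \<psi> where "\<psi> i j = (if i < l then P $$ (i, j) - (\<Sum>s<r. U $$ (i, s) * \<phi> s j) else 0)" for i j
    have t\<psi>: "?T (\<psi> i)" if "i < n" for i
    proof (cases "i < l")
      case True
      have "?T (\<lambda>j. P $$ (i, j) - (\<Sum>s<r. U $$ (i, s) * \<phi> s j))"
        using True that by (intro tail_span_diff tail_span_sum tail_span_scale tP t\<phi>) auto
      then show ?thesis using True by (simp add: \<psi>_def[abs_def])
    qed (simp add: \<psi>_def[abs_def] tail_span_zero)
    have "\<exists>g h. \<forall>j. l + m \<le> j \<longrightarrow> j < n \<longrightarrow>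
        f j = (\<Sum>t<p. g t * S $$ (j, t)) + (\<Sum>u<r. h u * C $$ (j, u))" if "?T f" for f
      using that S C unfolding tail_span_def by auto
    then obtain g h where gh: "\<And>f j. ?T f \<Longrightarrow> l + m \<le> j \<Longrightarrow> j < n \<Longrightarrow>
        f j = (\<Sum>t<p. g f t * S $$ (j, t)) + (\<Sum>u<r. h f u * C $$ (j, u))" by metis
    \<comment> \<open>The coefficients \<open>g\<close>, \<open>h\<close> are chosen as functions of
      the row, so one choice serves both \<phi> and \<psi>. What remains of a tame row lives in the
      first \<open>l + m\<close> columns and therefore fits into \<open>E\<close> or
      \<open>Z\<close>.\<close>
    define rest where "rest f j = f j - ((\<Sum>t<p. g f t * S $$ (j, t)) + (\<Sum>u<r. h f u * C $$ (j, u)))"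
      for f j
    define J where "J = mat r p (\<lambda>(s, t). g (\<phi> s) t)"
    define K where "K = mat r r (\<lambda>(s, u). h (\<phi> s) u)"
    define E where "E = mat r n (\<lambda>(s, j). rest (\<phi> s) j)"
    \<comment> \<open>The guard enforces the padding: for \<open>i\<close> at least \<open>l\<close>
      the row \<psi> i is zero, yet the coefficients chosen for the zero row may be nonzero.\<close>
    define X where "X = mat n p (\<lambda>(i, t). if i < l then g (\<psi> i) t else 0)"
    define Y where "Y = mat n r (\<lambda>(i, u). if i < l then h (\<psi> i) u else 0)"
    define Z where "Z = mat n n (\<lambda>(i, j). if i < l then rest (\<psi> i) j else 0)"
    have c: "J \<in> carrier_mat r p" "K \<in> carrier_mat r r" "E \<in> carrier_mat r n"
        "X \<in> carrier_mat n p" "Y \<in> carrier_mat n r" "Z \<in> carrier_mat n n"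
      by (auto simp: J_def K_def E_def X_def Y_def Z_def)
    have pad: "E \<in> padded_mats r (l + m) r n" "X \<in> padded_mats l p n p"
        "Y \<in> padded_mats l r n r" "Z \<in> padded_mats l (l + m) n n"
      using gh[OF t\<phi>] gh[OF t\<psi>]
      by (auto simp: padded_mats_def E_def X_def Y_def Z_def rest_def not_less)
    have M: "J * S\<^sup>T + K * C\<^sup>T + E \<in> carrier_mat r n" and N: "X * S\<^sup>T + Y * C\<^sup>T + Z \<in> carrier_mat n n"
      using c S C by auto
    have eM: "(J * S\<^sup>T + K * C\<^sup>T + E) $$ (s, j) = \<phi> s j" if "s < r" "j < n" for s j
      using comb[OF c(1-3) that] that by (simp add: J_def K_def E_def rest_def)
    have eN: "(X * S\<^sup>T + Y * C\<^sup>T + Z) $$ (i, j) = \<psi> i j" if "i < n" "j < n" for i j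
      using comb[OF c(4-6) that] that by (simp add: X_def Y_def Z_def rest_def \<psi>_def)
    have "P = U * (J * S\<^sup>T + K * C\<^sup>T + E) + (X * S\<^sup>T + Y * C\<^sup>T + Z)"
    proof (rule eq_matI)
      fix i j
      assume "i < dim_row (U * (J * S\<^sup>T + K * C\<^sup>T + E) + (X * S\<^sup>T + Y * C\<^sup>T + Z))"
        and "j < dim_col (U * (J * S\<^sup>T + K * C\<^sup>T + E) + (X * S\<^sup>T + Y * C\<^sup>T + Z))"
      then have ij: "i < n" "j < n" using N by auto
      show "P $$ (i, j) = (U * (J * S\<^sup>T + K * C\<^sup>T + E) + (X * S\<^sup>T + Y * C\<^sup>T + Z)) $$ (i, j)"
        unfolding ind[OF M N ij] eN[OF ij] using low[OF ij] ij by (simp add: eM \<psi>_def)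
    qed (use P N in auto)
    then have "P = U * J * S\<^sup>T + U * K * U\<^sup>T * A + U * E + X * S\<^sup>T + Y * U\<^sup>T * A + Z"
      using regroup[OF c] by simp
    then show ?L unfolding pert_space_def using c pad by blast
  qed
qed

text \<open>The band part is free near the diagonal, so only the entries outside the band matter.\<close>

lemma leading_blocks_iff:
  assumes F: "F \<in> carrier_mat n n" and U: "U \<in> carrier_mat n r" and S: "S \<in> carrier_mat n p"
    and C: "C \<in> carrier_mat n r" and k: "k \<le> n"
  shows "(\<exists>B \<in> band_mats n l b. \<exists>V \<in> carrier_mat n r. \<exists>W \<in> carrier_mat n (r + p).
        let G = B + strict_tril (U * V\<^sup>T) + strict_triu (W * (hcat S C)\<^sup>T)
        in block F 0 n 0 k = block G 0 n 0 k \<and> block F 0 k 0 n = block G 0 k 0 n) \<longleftrightarrow>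
    (\<forall>j<k. \<exists>v. \<forall>i. j + l < i \<longrightarrow> i < n \<longrightarrow> F $$ (i, j) = (\<Sum>s<r. U $$ (i, s) * v s)) \<and>
    (\<forall>i<k. tail_span S C (i + b + 1) (\<lambda>j. F $$ (i, j)))"
    (is "?L \<longleftrightarrow> ?R")
proof -
  have UV: "(U * V\<^sup>T) $$ (i, j) = (\<Sum>s<r. U $$ (i, s) * V $$ (j, s))"
    if "V \<in> carrier_mat n r" "i < n" "j < n" for V i j
    using that U by (subst index_mult_mat_sum[of _ n r _ n]) auto
  have WS: "(W * (hcat S C)\<^sup>T) $$ (i, j)
      = (\<Sum>t<p. W $$ (i, t) * S $$ (j, t)) + (\<Sum>u<r. W $$ (i, p + u) * C $$ (j, u))"
    if "W \<in> carrier_mat n (r + p)" "i < n" "j < n" for W i j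
  proof -
    have "(W * (hcat S C)\<^sup>T) $$ (i, j) = (\<Sum>t<p + r. W $$ (i, t) * hcat S C $$ (j, t))"
      using that S C
      by (subst index_mult_mat_sum[of _ n "p + r" _ n]) (auto simp: hcat_def add.commute)
    also have "\<dots> = (\<Sum>t<p. W $$ (i, t) * hcat S C $$ (j, t))
        + (\<Sum>u<r. W $$ (i, p + u) * hcat S C $$ (j, p + u))"
      by (induction r) (simp_all add: algebra_simps)
    finally show ?thesis using that S C by (simp add: hcat_def)
  qed
  have blocks: "block F 0 n 0 k = block G 0 n 0 k \<and> block F 0 k 0 n = block G 0 k 0 n \<longleftrightarrow>
      (\<forall>i<n. \<forall>j<n. i < k \<or> j < k \<longrightarrow> F $$ (i, j) = G $$ (i, j))" for G
    using k by (fastforce simp: block_def mat_eq_iff)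
  have G: "(B + strict_tril (U * V\<^sup>T) + strict_triu (W * (hcat S C)\<^sup>T)) $$ (i, j)
      = B $$ (i, j) + (if j < i then \<Sum>s<r. U $$ (i, s) * V $$ (j, s) else 0)
        + (if i < j then (\<Sum>t<p. W $$ (i, t) * S $$ (j, t))
             + (\<Sum>u<r. W $$ (i, p + u) * C $$ (j, u)) else 0)"
    if "V \<in> carrier_mat n r" "W \<in> carrier_mat n (r + p)" "i < n" "j < n" for B V W i j
    using that U S UV[OF that(1,3,4)] WS[OF that(2,3,4)]
    by (simp add: strict_tril_def strict_triu_def hcat_def del: index_mult_mat(1))
  show ?thesis
  proof
    assume ?L
    then obtain B V W where B: "B \<in> band_mats n l b" and V: "V \<in> carrier_mat n r"
      and W: "W \<in> carrier_mat n (r + p)"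
      and eq: "\<And>i j. i < n \<Longrightarrow> j < n \<Longrightarrow> i < k \<or> j < k \<Longrightarrow> F $$ (i, j)
        = (B + strict_tril (U * V\<^sup>T) + strict_triu (W * (hcat S C)\<^sup>T)) $$ (i, j)"
      unfolding Let_def blocks by blast
    have col: "F $$ (i, j) = (\<Sum>s<r. U $$ (i, s) * V $$ (j, s))"
      if "j < k" "j + l < i" "i < n" for i j
      using eq[of i j] G[OF V W, of i j B] B that k by (auto simp: band_mats_def)
    have row: "tail_span S C (i + b + 1) (\<lambda>j. F $$ (i, j))" if "i < k" for i
      unfolding tail_span_def using eq[of i] G[OF V W, of i _ B] B that k S C
      by (intro exI[of _ "\<lambda>t. W $$ (i, t)"] exI[of _ "\<lambda>u. W $$ (i, p + u)"])
        (auto simp: band_mats_def)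
    have "\<exists>v. \<forall>i. j + l < i \<longrightarrow> i < n \<longrightarrow> F $$ (i, j) = (\<Sum>s<r. U $$ (i, s) * v s)" if "j < k" for j
      using col[OF that] by (intro exI[of _ "\<lambda>s. V $$ (j, s)"]) simp
    with row show ?R by simp
  next
    assume R: ?R
    then obtain v where v: "\<And>i j. j < k \<Longrightarrow> j + l < i \<Longrightarrow> i < n \<Longrightarrow>
        F $$ (i, j) = (\<Sum>s<r. U $$ (i, s) * v j s)" by metis
    from R have "\<forall>i<k. \<exists>g h. \<forall>j. i + b + 1 \<le> j \<longrightarrow> j < n \<longrightarrow>
        F $$ (i, j) = (\<Sum>t<p. g t * S $$ (j, t)) + (\<Sum>u<r. h u * C $$ (j, u))"
      using S C unfolding tail_span_def by auto
    then obtain g h where gh: "\<And>i j. i < k \<Longrightarrow> i + b + 1 \<le> j \<Longrightarrow> j < n \<Longrightarrow>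
        F $$ (i, j) = (\<Sum>t<p. g i t * S $$ (j, t)) + (\<Sum>u<r. h i u * C $$ (j, u))" by metis
    define V where "V = mat n r (\<lambda>(j, s). v j s)"
    define W where "W = mat n (r + p) (\<lambda>(i, t). if t < p then g i t else h i (t - p))"
    \<comment> \<open>In the leading rows and columns \<open>B\<close> is whatever the two low-rank
      parts leave over; by \<open>v\<close> and \<open>gh\<close> this vanishes outside the band. On
      the trailing block, which neither comparison sees, \<open>B\<close> is set to zero.\<close>
    define B where "B = mat n n (\<lambda>(i, j). if i < k \<or> j < k then F $$ (i, j)
        - (if j < i then \<Sum>s<r. U $$ (i, s) * v j s else 0)
        - (if i < j then (\<Sum>t<p. g i t * S $$ (j, t)) + (\<Sum>u<r. h i u * C $$ (j, u)) else 0) else 0)"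
    have V: "V \<in> carrier_mat n r" and W: "W \<in> carrier_mat n (r + p)" by (auto simp: V_def W_def)
    have B: "B \<in> band_mats n l b" using v gh by (auto simp: band_mats_def B_def)
    have "F $$ (i, j) = (B + strict_tril (U * V\<^sup>T) + strict_triu (W * (hcat S C)\<^sup>T)) $$ (i, j)"
      if "i < n" "j < n" "i < k \<or> j < k" for i j
      unfolding G[OF V W that(1,2)] using that by (auto simp: B_def V_def W_def)
    then show ?L unfolding Let_def blocks using B V W by blast
  qed
qed

section \<open>A fixed representation: entries of A, its trailing blocks, and membership in
  BPSF\<close>

locale bps =
  fixes n r p l m :: nat and A B U V W S :: "real mat"
  assumes rep: "bps_rep n r p l m A B U V W S"
begin

abbreviation tail where "tail \<equiv> tail_span S (A\<^sup>T * U)"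

lemma carriers:
  "U \<in> carrier_mat n r" "V \<in> carrier_mat n r" "W \<in> carrier_mat n p" "S \<in> carrier_mat n p"
  "A \<in> carrier_mat n n"
  using rep by (auto simp: bps_rep_def band_mats_def strict_tril_def strict_triu_def)

lemma dims[simp]:
  "dim_row U = n" "dim_col U = r" "dim_row S = n" "dim_col S = p" "dim_row A = n" "dim_col A = n"
  using carriers by auto

lemma A_entry:
  assumes "i < n" "j < n"
  shows "A $$ (i, j) = B $$ (i, j) + (if j < i then \<Sum>s<r. U $$ (i, s) * V $$ (j, s) else 0)
    + (if i < j then \<Sum>t<p. W $$ (i, t) * S $$ (j, t) else 0)"
proof -
  have "(U * V\<^sup>T) $$ (i, j) = (\<Sum>s<r. U $$ (i, s) * V $$ (j, s))"
    using carriers assms by (subst index_mult_mat_sum[of _ n r _ n]) auto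
  moreover have "(W * S\<^sup>T) $$ (i, j) = (\<Sum>t<p. W $$ (i, t) * S $$ (j, t))"
    using carriers assms by (subst index_mult_mat_sum[of _ n p _ n]) auto
  moreover have "A = B + strict_tril (U * V\<^sup>T) + strict_triu (W * S\<^sup>T)"
    using rep by (simp add: bps_rep_def)
  ultimately show ?thesis using carriers assms
    by (auto simp: strict_tril_def strict_triu_def simp del: index_mult_mat(1))
qed

lemma A_below_band:
  assumes "j + l < i" "i < n"
  shows "A $$ (i, j) = (\<Sum>s<r. U $$ (i, s) * V $$ (j, s))"
  using A_entry[of i j] assms rep by (auto simp: bps_rep_def band_mats_def)

lemma A_above_band:
  assumes "i + m < j" "j < n"
  shows "A $$ (i, j) = (\<Sum>t<p. W $$ (i, t) * S $$ (j, t))"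
  using A_entry[of i j] assms rep by (auto simp: bps_rep_def band_mats_def)

lemma tail_A_row:
  assumes "i + m + 1 \<le> c"
  shows "tail c (\<lambda>j. A $$ (i, j))"
proof (rule tail_span_cong)
  show "tail c (\<lambda>j. \<Sum>t<p. W $$ (i, t) * S $$ (j, t))" using tail_span_left[of S] by simp
qed (use assms in \<open>simp add: A_above_band\<close>)

lemma AtU_entry:
  assumes "j < n" "u < r"
  shows "(A\<^sup>T * U) $$ (j, u) = (\<Sum>i<n. U $$ (i, u) * A $$ (i, j))"
  using carriers assms
  by (subst index_mult_mat_sum[of _ n n _ r]) (auto simp: mult.commute intro!: sum.cong)

lemma AtU_split:
  assumes "j < n" "u < r" "q \<le> n"
  shows "(A\<^sup>T * U) $$ (j, u)
    = (\<Sum>i<q. U $$ (i, u) * A $$ (i, j)) + (\<Sum>i=q..<n. U $$ (i, u) * A $$ (i, j))"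
  unfolding AtU_entry[OF assms(1,2)]
  using sum.atLeastLessThan_concat[of 0 q n "\<lambda>i. U $$ (i, u) * A $$ (i, j)"] assms(3)
  by (simp add: atLeast0LessThan)

text \<open>The sum is column \<open>u\<close> of \<open>A\<^sup>T * U\<close> less the contribution
  of the rows above \<open>q\<close>. The last of these, row \<open>q - 1\<close>, has left the band
  of \<open>A\<close> from column \<open>q + m\<close> on, so all of them are tame there.\<close>

lemma tail_AtU_trailing:
  assumes "u < r" "q \<le> n" "q + m \<le> c"
  shows "tail c (\<lambda>j. \<Sum>i=q..<n. U $$ (i, u) * A $$ (i, j))"
proof (rule tail_span_cong)
  show "tail c (\<lambda>j. (A\<^sup>T * U) $$ (j, u) - (\<Sum>i<q. U $$ (i, u) * A $$ (i, j)))"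
    using assms carriers
    by (intro tail_span_diff tail_span_right tail_span_sum tail_span_scale tail_A_row) auto
qed (use AtU_split[OF _ assms(1,2)] in \<open>simp del: index_mult_mat(1)\<close>)

text \<open>The rows of \<open>A\<close> above the trailing block lie, beyond the band, in the row space of \<open>S\<^sup>T\<close>; hence
  \<open>U\<^sup>T A\<close> may be replaced by its analogue for the trailing block.\<close>

lemma tail_block_iff:
  assumes q: "q \<le> n" and c: "m \<le> c"
  shows "tail_span (block S q n 0 p) ((block A q n q n)\<^sup>T * block U q n 0 r) c f
    \<longleftrightarrow> tail (q + c) (\<lambda>j. f (j - q))"
proof -
  let ?D = "\<lambda>u j. \<Sum>i=q..<n. U $$ (i, u) * A $$ (i, j)"
  let ?C = "(block A q n q n)\<^sup>T * block U q n 0 r"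
  have D: "?C $$ (j, u) = ?D u (q + j)" if "j < n - q" "u < r" for j u
  proof -
    have "?C $$ (j, u) = (\<Sum>i<n - q. A $$ (q + i, q + j) * U $$ (q + i, u))"
      using that by (subst index_mult_mat_sum[of _ "n - q" "n - q" _ r]) (auto simp: block_def)
    also have "\<dots> = ?D u (q + j)"
      using sum.shift_bounds_nat_ivl[of "\<lambda>i. U $$ (i, u) * A $$ (i, q + j)" 0 q "n - q"] q
      by (simp add: atLeast0LessThan add.commute mult.commute)
    finally show ?thesis .
  qed
  have d: "dim_row (block S q n 0 p) = n - q" "dim_col (block S q n 0 p) = p" "dim_col ?C = r"
    by (auto simp: block_def)
  have block: "tail_span (block S q n 0 p) ?C c f \<longleftrightarrow> (\<exists>g h. \<forall>j. q + c \<le> j \<longrightarrow> j < n \<longrightarrow>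
      f (j - q) = (\<Sum>t<p. g t * S $$ (j, t)) + (\<Sum>u<r. h u * ?D u j))" (is "_ \<longleftrightarrow> (\<exists>g h. ?P g h)")
  proof -
    have "(\<forall>j. c \<le> j \<longrightarrow> j < n - q \<longrightarrow>
        f j = (\<Sum>t<p. g t * block S q n 0 p $$ (j, t)) + (\<Sum>u<r. h u * ?C $$ (j, u)))
      \<longleftrightarrow> ?P g h" (is "?Q \<longleftrightarrow> _") for g h
    proof
      assume Q: ?Q
      show "?P g h"
      proof (intro allI impI)
        fix j assume "q + c \<le> j" "j < n"
        then show "f (j - q) = (\<Sum>t<p. g t * S $$ (j, t)) + (\<Sum>u<r. h u * ?D u j)"
          using Q[rule_format, of "j - q"] D[of "j - q"] by (simp add: block_def)
      qed
    next
      assume P: "?P g h"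
      show ?Q
      proof (intro allI impI)
        fix j assume "c \<le> j" "j < n - q"
        then show "f j = (\<Sum>t<p. g t * block S q n 0 p $$ (j, t)) + (\<Sum>u<r. h u * ?C $$ (j, u))"
          using P[rule_format, of "q + j"] D[of j] by (simp add: block_def)
      qed
    qed
    then show ?thesis unfolding tail_span_def d by simp
  qed
  show ?thesis unfolding block
  proof
    assume "\<exists>g h. ?P g h"
    then obtain g h where gh: "?P g h" by blast
    show "tail (q + c) (\<lambda>j. f (j - q))"
    proof (rule tail_span_cong)
      show "tail (q + c) (\<lambda>j. (\<Sum>t<p. g t * S $$ (j, t)) + (\<Sum>u<r. h u * ?D u j))"
      proof (rule tail_span_add)
        show "tail (q + c) (\<lambda>j. \<Sum>t<p. g t * S $$ (j, t))"
          using tail_span_left[of S "A\<^sup>T * U" "q + c" g] by simp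
        show "tail (q + c) (\<lambda>j. \<Sum>u<r. h u * ?D u j)"
          by (rule tail_span_sum, rule tail_span_scale, rule tail_AtU_trailing) (use q c in auto)
      qed
    qed (use gh in simp)
  next
    assume "tail (q + c) (\<lambda>j. f (j - q))"
    then obtain g h where gh: "\<And>j. q + c \<le> j \<Longrightarrow> j < n \<Longrightarrow>
        f (j - q) = (\<Sum>t<p. g t * S $$ (j, t)) + (\<Sum>u<r. h u * (A\<^sup>T * U) $$ (j, u))"
      unfolding tail_span_def by auto
    \<comment> \<open>As \<open>m\<close> is at most \<open>c\<close>, every row of \<open>A\<close>
      above \<open>q\<close> equals its row of W S^T from column \<open>q + c\<close> on. So the
      part of column \<open>u\<close> that these rows contribute is a combination of the columns of
      \<open>S\<close>, with coefficients \<open>w u\<close>, and can be moved into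
      \<open>g\<close>.\<close>
    define w where "w u t = (\<Sum>i<q. U $$ (i, u) * W $$ (i, t))" for u t
    have "f (j - q) = (\<Sum>t<p. (g t + (\<Sum>u<r. h u * w u t)) * S $$ (j, t)) + (\<Sum>u<r. h u * ?D u j)"
      if j: "q + c \<le> j" "j < n" for j
    proof -
      have "(A\<^sup>T * U) $$ (j, u) = (\<Sum>t<p. w u t * S $$ (j, t)) + ?D u j" if "u < r" for u
      proof -
        have "(\<Sum>i<q. U $$ (i, u) * A $$ (i, j))
            = (\<Sum>i<q. \<Sum>t<p. U $$ (i, u) * W $$ (i, t) * S $$ (j, t))"
          using j c by (intro sum.cong) (auto simp: A_above_band sum_distrib_left mult.assoc)
        also have "\<dots> = (\<Sum>t<p. w u t * S $$ (j, t))"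
          by (subst sum.swap) (simp add: w_def sum_distrib_right)
        finally show ?thesis using AtU_split[OF j(2) that q] by simp
      qed
      moreover have "(\<Sum>u<r. h u * (\<Sum>t<p. w u t * S $$ (j, t)))
          = (\<Sum>t<p. (\<Sum>u<r. h u * w u t) * S $$ (j, t))"
        by (simp add: sum_distrib_left sum_distrib_right mult.assoc) (rule sum.swap)
      ultimately show ?thesis
        unfolding gh[OF j] by (simp add: algebra_simps sum.distrib)
    qed
    then show "\<exists>g h. ?P g h"
      by (intro exI[of _ "\<lambda>t. g t + (\<Sum>u<r. h u * w u t)"] exI[of _ h]) simp
  qed
qed

text \<open>The perturbation is forced to be the difference F - A on the trailing block. In its
  first \<open>l\<close> rows \<open>A\<close> is itself tame from \<open>k + l + m\<close> on, so
  there the condition on the difference becomes one on \<open>F\<close> alone; on the lower rows the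
  difference has to be kept.\<close>

lemma trailing_block_iff:
  assumes k: "k \<le> n"
  shows "(\<exists>P \<in> pert_space (n - k) r p l m (block U k n 0 r) (block S k n 0 p) (block A k n k n).
        block F k n k n = block A k n k n + P) \<longleftrightarrow>
    (\<exists>\<phi>. (\<forall>s<r. tail (k + l + m) (\<phi> s)) \<and>
      (\<forall>i. k \<le> i \<longrightarrow> i < n \<longrightarrow> i < k + l \<longrightarrow> tail (k + l + m) (\<lambda>j. F $$ (i, j))) \<and>
      (\<forall>i j. k + l \<le> i \<longrightarrow> i < n \<longrightarrow> k \<le> j \<longrightarrow> j < n \<longrightarrow>
        F $$ (i, j) = A $$ (i, j) + (\<Sum>s<r. U $$ (i, s) * \<phi> s j)))"
    (is "?L \<longleftrightarrow> ?R")
proof -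
  let ?A = "block A k n k n" and ?U = "block U k n 0 r" and ?S = "block S k n 0 p"
  let ?N = "n - k"
  have c: "?U \<in> carrier_mat ?N r" "?S \<in> carrier_mat ?N p" "?A \<in> carrier_mat ?N ?N"
    by (auto simp: block_def)
  let ?P = "mat ?N ?N (\<lambda>(i, j). F $$ (k + i, k + j) - A $$ (k + i, k + j))"
  have "?L \<longleftrightarrow> ?P \<in> pert_space ?N r p l m ?U ?S ?A"
  proof
    assume ?L
    then obtain P where P: "P \<in> pert_space ?N r p l m ?U ?S ?A" "block F k n k n = ?A + P" by blast
    have Pc: "P \<in> carrier_mat ?N ?N" using P(1) pert_space_iff[OF c refl] by blast
    have "P = ?P"
    proof (rule eq_matI)
      fix i j assume ij: "i < dim_row ?P" "j < dim_col ?P"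
      then have "block F k n k n $$ (i, j) = (?A + P) $$ (i, j)" using P(2) by simp
      then show "P $$ (i, j) = ?P $$ (i, j)" using ij Pc by (simp add: block_def)
    qed (use Pc in auto)
    then show "?P \<in> pert_space ?N r p l m ?U ?S ?A" using P by simp
  next
    assume "?P \<in> pert_space ?N r p l m ?U ?S ?A"
    moreover have "block F k n k n = ?A + ?P" by (rule eq_matI) (auto simp: block_def)
    ultimately show ?L by blast
  qed
  also have "\<dots> \<longleftrightarrow> (\<exists>\<phi>. (\<forall>s<r. tail (k + (l + m)) (\<lambda>j. \<phi> s (j - k))) \<and>
         (\<forall>i<?N. i < l \<longrightarrow> tail (k + (l + m)) (\<lambda>j. ?P $$ (i, j - k))) \<and>
         (\<forall>i<?N. \<forall>j<?N. l \<le> i \<longrightarrow> ?P $$ (i, j) = (\<Sum>s<r. ?U $$ (i, s) * \<phi> s j)))"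
    unfolding pert_space_iff[OF c refl] tail_block_iff[OF k le_add2] by simp
  also have "\<dots> \<longleftrightarrow> ?R"
  proof -
    have row: "tail (k + (l + m)) (\<lambda>j. ?P $$ (i, j - k)) \<longleftrightarrow> tail (k + l + m) (\<lambda>j. F $$ (k + i, j))"
      if "i < ?N" "i < l" for i
    proof -
      \<comment> \<open>The last row concerned is \<open>k + l - 1\<close>, and its tail in
        \<open>A\<close> starts at (k + l - 1) + m + 1, which is exactly
        \<open>k + l + m\<close>.\<close>
      have tA: "tail (k + l + m) (\<lambda>j. A $$ (k + i, j))" using that by (intro tail_A_row) simp
      have e: "?P $$ (i, j - k) = F $$ (k + i, j) - A $$ (k + i, j)" if "k + l + m \<le> j" "j < n" for j
        using that \<open>i < ?N\<close> by simp
      show ?thesis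
      proof
        assume "tail (k + (l + m)) (\<lambda>j. ?P $$ (i, j - k))"
        then have "tail (k + l + m) (\<lambda>j. ?P $$ (i, j - k) + A $$ (k + i, j))"
          using tA by (intro tail_span_add) (simp_all add: add.assoc)
        then show "tail (k + l + m) (\<lambda>j. F $$ (k + i, j))"
          by (rule tail_span_cong) (use e in simp)
      next
        assume "tail (k + l + m) (\<lambda>j. F $$ (k + i, j))"
        from tail_span_diff[OF this tA] have "tail (k + l + m) (\<lambda>j. ?P $$ (i, j - k))"
          by (rule tail_span_cong) (use e in simp)
        then show "tail (k + (l + m)) (\<lambda>j. ?P $$ (i, j - k))" by (simp add: add.assoc)
      qed
    qed
    show ?thesis
    proof
      assume "\<exists>\<phi>. (\<forall>s<r. tail (k + (l + m)) (\<lambda>j. \<phi> s (j - k))) \<and>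
         (\<forall>i<?N. i < l \<longrightarrow> tail (k + (l + m)) (\<lambda>j. ?P $$ (i, j - k))) \<and>
         (\<forall>i<?N. \<forall>j<?N. l \<le> i \<longrightarrow> ?P $$ (i, j) = (\<Sum>s<r. ?U $$ (i, s) * \<phi> s j))"
      then obtain \<phi> where h1: "\<And>s. s < r \<Longrightarrow> tail (k + (l + m)) (\<lambda>j. \<phi> s (j - k))"
        and h2: "\<And>i. i < ?N \<Longrightarrow> i < l \<Longrightarrow> tail (k + (l + m)) (\<lambda>j. ?P $$ (i, j - k))"
        and h3: "\<And>i j. i < ?N \<Longrightarrow> j < ?N \<Longrightarrow> l \<le> i \<Longrightarrow> ?P $$ (i, j) = (\<Sum>s<r. ?U $$ (i, s) * \<phi> s j)"
        by blast
      have "tail (k + l + m) (\<lambda>j. F $$ (i, j))" if "k \<le> i" "i < n" "i < k + l" for i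
        using row[of "i - k"] h2[of "i - k"] that by simp
      moreover have "F $$ (i, j) = A $$ (i, j) + (\<Sum>s<r. U $$ (i, s) * \<phi> s (j - k))"
        if "k + l \<le> i" "i < n" "k \<le> j" "j < n" for i j
      proof -
        have "i - k < ?N" "j - k < ?N" "l \<le> i - k" using that by auto
        from h3[OF this] show ?thesis using that by (simp add: block_def)
      qed
      ultimately show ?R using h1
        by (intro exI[of _ "\<lambda>s j. \<phi> s (j - k)"]) (simp add: add.assoc)
    next
      assume ?R
      then obtain \<phi> where h1: "\<And>s. s < r \<Longrightarrow> tail (k + l + m) (\<phi> s)"
        and h2: "\<And>i. k \<le> i \<Longrightarrow> i < n \<Longrightarrow> i < k + l \<Longrightarrow> tail (k + l + m) (\<lambda>j. F $$ (i, j))"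
        and h3: "\<And>i j. k + l \<le> i \<Longrightarrow> i < n \<Longrightarrow> k \<le> j \<Longrightarrow> j < n \<Longrightarrow>
          F $$ (i, j) = A $$ (i, j) + (\<Sum>s<r. U $$ (i, s) * \<phi> s j)" by blast
      have "tail (k + (l + m)) (\<lambda>j. (\<lambda>j. \<phi> s (k + j)) (j - k))" if "s < r" for s
        by (rule tail_span_cong[of _ _ _ "\<phi> s"]) (use h1[OF that] in \<open>simp_all add: add.assoc\<close>)
      moreover have "tail (k + (l + m)) (\<lambda>j. ?P $$ (i, j - k))" if "i < ?N" "i < l" for i
        using row[OF that] h2[of "k + i"] that by simp
      moreover have "?P $$ (i, j) = (\<Sum>s<r. ?U $$ (i, s) * \<phi> s (k + j))"
        if "i < ?N" "j < ?N" "l \<le> i" for i j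
        using h3[of "k + i" "k + j"] that by (simp add: block_def)
      ultimately show "\<exists>\<phi>. (\<forall>s<r. tail (k + (l + m)) (\<lambda>j. \<phi> s (j - k))) \<and>
         (\<forall>i<?N. i < l \<longrightarrow> tail (k + (l + m)) (\<lambda>j. ?P $$ (i, j - k))) \<and>
         (\<forall>i<?N. \<forall>j<?N. l \<le> i \<longrightarrow> ?P $$ (i, j) = (\<Sum>s<r. ?U $$ (i, s) * \<phi> s j))"
        by (intro exI[of _ "\<lambda>s j. \<phi> s (k + j)"]) blast
    qed
  qed
  finally show ?thesis .
qed

lemma bpsf_iff:
  assumes "k \<le> n" "F \<in> carrier_mat n n"
  shows "F \<in> bpsf n r p l m U S A k \<longleftrightarrow>
    (\<forall>j<k. \<exists>v. \<forall>i. j + l < i \<longrightarrow> i < n \<longrightarrow> F $$ (i, j) = (\<Sum>s<r. U $$ (i, s) * v s)) \<and>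
    (\<forall>i<k. tail (i + (l + m) + 1) (\<lambda>j. F $$ (i, j))) \<and>
    (\<exists>\<phi>. (\<forall>s<r. tail (k + l + m) (\<phi> s)) \<and>
      (\<forall>i. k \<le> i \<longrightarrow> i < n \<longrightarrow> i < k + l \<longrightarrow> tail (k + l + m) (\<lambda>j. F $$ (i, j))) \<and>
      (\<forall>i j. k + l \<le> i \<longrightarrow> i < n \<longrightarrow> k \<le> j \<longrightarrow> j < n \<longrightarrow>
        F $$ (i, j) = A $$ (i, j) + (\<Sum>s<r. U $$ (i, s) * \<phi> s j)))"
proof -
  have "A\<^sup>T * U \<in> carrier_mat n r" using carriers by simp
  note lead = leading_blocks_iff[OF assms(2) carriers(1,4) this assms(1)]
  show ?thesis unfolding bpsf_def mem_Collect_eq lead trailing_block_iff[OF assms(1)]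
    by (simp only: assms(2) simp_thms conj_assoc)
qed

section \<open>One Householder step on the partial factor\<close>

lemma qr_iter_carrier: "qr_iter A q \<in> carrier_mat n n"
proof (induction q)
  case (Suc q)
  then show ?case unfolding qr_iter.simps Let_def
    by (intro mult_carrier_mat[of _ n n] carrier_matI) (auto simp: hh_vec_def Let_def outer_def)
qed (use carriers in simp)

lemma partial_factor_carrier: "partial_factor A q \<in> carrier_mat n n"
  by (simp add: partial_factor_def)

lemma hh_vec_above_pivot: "i < n \<Longrightarrow> i < q \<Longrightarrow> hh_vec q (qr_iter A q) $ i = 0"
  using qr_iter_carrier[of q] by (simp add: hh_vec_def Let_def)

text \<open>Below the pivot the reflection vector is column \<open>q\<close> divided by a single
  scalar. If that scalar is 0, both sides are 0 by the convention for division, so no case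
  distinction arises.\<close>

lemma hh_vec_below_pivot:
  assumes "q < i" "i < n"
  shows "hh_vec q (qr_iter A q) $ i
    = qr_iter A q $$ (i, q) / hh_alpha (vec (n - q) (\<lambda>i. qr_iter A q $$ (q + i, q)))"
proof -
  have "q + (i - q) = i" using assms by simp
  then show ?thesis using assms qr_iter_carrier[of q] by (simp add: hh_vec_def Let_def)
qed

text \<open>The sum starts at \<open>q\<close> because the reflection vector vanishes above its
  pivot; thus only rows of the trailing block, which the BPSF hypothesis controls, are
  mixed.\<close>

lemma qr_iter_Suc_entry:
  assumes "i < n" "j < n" "q \<le> n"
  shows "qr_iter A (Suc q) $$ (i, j) = qr_iter A q $$ (i, j) - hh_tau (hh_vec q (qr_iter A q))
    * hh_vec q (qr_iter A q) $ i * (\<Sum>a=q..<n. hh_vec q (qr_iter A q) $ a * qr_iter A q $$ (a, j))"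
proof -
  define M where "M = qr_iter A q"
  define y where "y = hh_vec q M"
  have M: "M \<in> carrier_mat n n" unfolding M_def by (rule qr_iter_carrier)
  have y: "dim_vec y = n" using M by (simp add: y_def hh_vec_def Let_def)
  have "qr_iter A (Suc q) $$ (i, j) = ((1\<^sub>m n - hh_tau y \<cdot>\<^sub>m outer y y) * M) $$ (i, j)"
    by (simp add: Let_def M_def y_def)
  also have "\<dots> = (\<Sum>a<n. (1\<^sub>m n - hh_tau y \<cdot>\<^sub>m outer y y) $$ (i, a) * M $$ (a, j))"
    using M y assms by (intro index_mult_mat_sum[of _ n n _ n]) (auto simp: outer_def)
  also have "\<dots> = (\<Sum>a<n. (if a = i then M $$ (a, j) else 0) - hh_tau y * y $ i * (y $ a * M $$ (a, j)))"
    using y assms by (intro sum.cong) (auto simp: outer_def algebra_simps)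
  also have "\<dots> = M $$ (i, j) - hh_tau y * y $ i * (\<Sum>a<n. y $ a * M $$ (a, j))"
    using assms by (simp add: sum_subtractf sum_distrib_left)
  also have "(\<Sum>a<n. y $ a * M $$ (a, j)) = (\<Sum>a=q..<n. y $ a * M $$ (a, j))"
    using hh_vec_above_pivot by (intro sum.mono_neutral_right) (auto simp: y_def M_def)
  finally show ?thesis unfolding y_def M_def .
qed

lemma bpsf_Suc:
  assumes q: "Suc q < n" and prev: "partial_factor A q \<in> bpsf n r p l m U S A q"
  shows "partial_factor A (Suc q) \<in> bpsf n r p l m U S A (Suc q)"
proof -
  define F where "F = partial_factor A q"
  define F' where "F' = partial_factor A (Suc q)"
  define y where "y = hh_vec q (qr_iter A q)"
  define z where "z j = (\<Sum>a=q..<n. y $ a * F $$ (a, j))" for j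
  \<comment> \<open>This start serves two purposes: it is \<open>Suc q + l + m\<close>, required in
    the new trailing block, and \<open>q + (l + m) + 1\<close>, required of the pivot row once it is
    finished.\<close>
  define c where "c = q + l + m + 1"
  have F: "F \<in> carrier_mat n n" and F': "F' \<in> carrier_mat n n"
    unfolding F_def F'_def by (rule partial_factor_carrier)+
  \<comment> \<open>Below the diagonal, columns before \<open>q\<close> store earlier reflection
    vectors; every other entry in question lies in a row above \<open>q\<close>, where the new
    reflection vector is zero.\<close>
  have old: "F' $$ (i, j) = F $$ (i, j)" if "i < q \<or> j < q" "i < n" "j < n" for i j
    using that q qr_iter_Suc_entry[of i j q] hh_vec_above_pivot[of i q]
    by (auto simp: F_def F'_def partial_factor_def simp del: qr_iter.simps)
  have Fq: "F $$ (i, j) = qr_iter A q $$ (i, j)" if "q \<le> i" "q \<le> j" "i < n" "j < n" for i j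
    using that by (simp add: F_def partial_factor_def)
  have col: "F' $$ (i, q) = y $ i" if "q < i" "i < n" for i
    using that q by (simp add: F'_def partial_factor_def y_def)
  \<comment> \<open>Column \<open>q\<close> is excluded because below the pivot it now stores
    \<open>y\<close>; tails from \<open>c\<close> on lie strictly to its right.\<close>
  have new: "F' $$ (i, j) = F $$ (i, j) - hh_tau y * y $ i * z j"
    if "q \<le> i" "q < j" "i < n" "j < n" for i j
  proof -
    have "F' $$ (i, j) = qr_iter A (Suc q) $$ (i, j)"
      using that by (simp add: F'_def partial_factor_def del: qr_iter.simps)
    then show ?thesis using that q by (simp add: qr_iter_Suc_entry z_def y_def Fq del: qr_iter.simps)
  qed

  from prev[folded F_def, unfolded bpsf_iff[OF less_imp_le[OF Suc_lessD[OF q]] F]]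
  obtain \<phi> where cols: "\<And>j. j < q \<Longrightarrow>
      \<exists>v. \<forall>i. j + l < i \<longrightarrow> i < n \<longrightarrow> F $$ (i, j) = (\<Sum>s<r. U $$ (i, s) * v s)"
    and rows: "\<And>i. i < q \<Longrightarrow> tail (i + (l + m) + 1) (\<lambda>j. F $$ (i, j))"
    and t\<phi>: "\<And>s. s < r \<Longrightarrow> tail (q + l + m) (\<phi> s)"
    and tF: "\<And>i. q \<le> i \<Longrightarrow> i < n \<Longrightarrow> i < q + l \<Longrightarrow> tail (q + l + m) (\<lambda>j. F $$ (i, j))"
    and low: "\<And>i j. q + l \<le> i \<Longrightarrow> i < n \<Longrightarrow> q \<le> j \<Longrightarrow> j < n \<Longrightarrow>
        F $$ (i, j) = A $$ (i, j) + (\<Sum>s<r. U $$ (i, s) * \<phi> s j)"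
    by blast
  have t\<phi>c: "tail c (\<phi> s)" if "s < r" for s
    using t\<phi>[OF that] by (rule tail_span_mono) (simp add: c_def)
  \<comment> \<open>One row more than in \<open>tF\<close>: row \<open>q + l\<close> is still of the
    form A + U \<phi>, and the tail of its \<open>A\<close> part starts at q + l + m + 1, that is at
    \<open>c\<close>.\<close>
  have tFc: "tail c (\<lambda>j. F $$ (i, j))" if "q \<le> i" "i < n" "i \<le> q + l" for i
  proof (cases "i < q + l")
    case True
    with tF that show ?thesis by (intro tail_span_mono[of _ _ "q + l + m" _ c]) (auto simp: c_def)
  next
    case False
    have "tail c (\<lambda>j. A $$ (i, j) + (\<Sum>s<r. U $$ (i, s) * \<phi> s j))"
      using that
      by (intro tail_span_add tail_span_sum tail_span_scale t\<phi>c tail_A_row) (auto simp: c_def)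
    then show ?thesis by (rule tail_span_cong) (use low[of i] that False in \<open>auto simp: c_def\<close>)
  qed

  obtain v where v: "\<And>i. q + l < i \<Longrightarrow> i < n \<Longrightarrow> y $ i = (\<Sum>s<r. U $$ (i, s) * v s)"
  proof -
    obtain \<alpha> where \<alpha>: "\<And>i. q < i \<Longrightarrow> i < n \<Longrightarrow> y $ i = qr_iter A q $$ (i, q) / \<alpha>"
      using hh_vec_below_pivot unfolding y_def by blast
    \<comment> \<open>Below row \<open>q + l\<close>, column \<open>q\<close> of \<open>A\<close> is
      given by U V^T alone, and the perturbation adds U times the values of \<phi> in column
      \<open>q\<close>. Hence column \<open>q\<close> of \<open>F\<close>, and with it
      \<open>y\<close>, lies there in the column space of \<open>U\<close>.\<close>
    have "y $ i = (\<Sum>s<r. U $$ (i, s) * ((V $$ (q, s) + \<phi> s q) / \<alpha>))" if "q + l < i" "i < n" for i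
    proof -
      have "y $ i = F $$ (i, q) / \<alpha>" using \<alpha>[of i] Fq[of i q] that by simp
      also have "F $$ (i, q) = (\<Sum>s<r. U $$ (i, s) * (V $$ (q, s) + \<phi> s q))"
        using low[of i q] A_below_band[of q i] that by (simp add: algebra_simps sum.distrib)
      finally show ?thesis by (simp add: sum_divide_distrib)
    qed
    then show ?thesis by (rule that)
  qed

  \<comment> \<open>Up to \<open>(U v)\<^sup>T A\<close>, only the rows up to \<open>q + l\<close> and the perturbation contribute to \<open>y\<^sup>T F\<close>.\<close>
  have tz: "tail c z"
  proof (rule tail_span_cong)
    \<comment> \<open>The term with U v is subtracted in every row from \<open>q\<close> on,
      including those where \<open>y\<close> differs from U v. Its total is then \<open>v\<close>
      applied to the full trailing sums of \<open>tail_AtU_trailing\<close>.\<close>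
    let ?d = "\<lambda>i j. y $ i * F $$ (i, j) - (\<Sum>s<r. U $$ (i, s) * v s) * A $$ (i, j)"
    have "tail c (?d i)" if i: "i \<in> {q..<n}" for i
    proof (cases "i \<le> q + l")
      case True
      then show ?thesis using i
        by (intro tail_span_diff tail_span_scale tFc tail_A_row) (auto simp: c_def)
    next
      case False
      \<comment> \<open>Here y = U v and F = A + U \<phi>, so the \<open>A\<close> terms cancel in
        \<open>?d\<close> and only the perturbation is left.\<close>
      have "tail c (\<lambda>j. y $ i * (\<Sum>s<r. U $$ (i, s) * \<phi> s j))"
        by (intro tail_span_scale tail_span_sum t\<phi>c) simp
      then show ?thesis
        by (rule tail_span_cong) (use low[of i] v[of i] i False in \<open>auto simp: c_def algebra_simps\<close>)
    qed
    then show "tail c (\<lambda>j. (\<Sum>s<r. v s * (\<Sum>i=q..<n. U $$ (i, s) * A $$ (i, j)))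
        + (\<Sum>i=q..<n. ?d i j))"
      using q tail_AtU_trailing[of _ q c]
      by (intro tail_span_add tail_span_sum) (auto simp: c_def intro!: tail_span_scale)
    fix j
    have "(\<Sum>i=q..<n. (\<Sum>s<r. U $$ (i, s) * v s) * A $$ (i, j))
        = (\<Sum>s<r. v s * (\<Sum>i=q..<n. U $$ (i, s) * A $$ (i, j)))"
      by (simp add: sum_distrib_left sum_distrib_right ac_simps) (rule sum.swap)
    then show "z j = (\<Sum>s<r. v s * (\<Sum>i=q..<n. U $$ (i, s) * A $$ (i, j))) + (\<Sum>i=q..<n. ?d i j)"
      by (simp add: z_def sum_subtractf)
  qed
  have tF': "tail c (\<lambda>j. F' $$ (i, j))" if "q \<le> i" "i < n" "i \<le> q + l" for i
  proof (rule tail_span_cong)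
    show "tail c (\<lambda>j. F $$ (i, j) - hh_tau y * y $ i * z j)"
      by (intro tail_span_diff tail_span_scale tFc tz that)
  qed (use new that in \<open>auto simp: c_def\<close>)

  have "\<exists>w. \<forall>i. j + l < i \<longrightarrow> i < n \<longrightarrow> F' $$ (i, j) = (\<Sum>s<r. U $$ (i, s) * w s)" if "j < Suc q" for j
  proof (cases "j = q")
    case True
    then show ?thesis using col v by (intro exI[of _ v]) auto
  next
    case False
    with that have "j < q" by simp
    then show ?thesis using cols[of j] old[of _ j] q by auto
  qed
  moreover have "tail (i + (l + m) + 1) (\<lambda>j. F' $$ (i, j))" if "i < Suc q" for i
  proof (cases "i = q")
    case True
    then show ?thesis using tF'[of q] q by (simp add: c_def add.assoc)
  next
    case False
    with that have "i < q" by simp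
    from rows[OF this] show ?thesis
      by (rule tail_span_cong) (use old[of i] \<open>i < q\<close> q in auto)
  qed
  moreover have "\<exists>\<phi>'. (\<forall>s<r. tail (Suc q + l + m) (\<phi>' s)) \<and>
      (\<forall>i. Suc q \<le> i \<longrightarrow> i < n \<longrightarrow> i < Suc q + l \<longrightarrow> tail (Suc q + l + m) (\<lambda>j. F' $$ (i, j))) \<and>
      (\<forall>i j. Suc q + l \<le> i \<longrightarrow> i < n \<longrightarrow> Suc q \<le> j \<longrightarrow> j < n \<longrightarrow>
        F' $$ (i, j) = A $$ (i, j) + (\<Sum>s<r. U $$ (i, s) * \<phi>' s j))"
  proof (intro exI[of _ "\<lambda>s j. \<phi> s j - hh_tau y * v s * z j"] conjI allI impI)
    have cS: "Suc q + l + m = c" by (simp add: c_def)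
    show "tail (Suc q + l + m) (\<lambda>j. \<phi> s j - hh_tau y * v s * z j)" if "s < r" for s
      unfolding cS by (intro tail_span_diff tail_span_scale t\<phi>c tz that)
    show "tail (Suc q + l + m) (\<lambda>j. F' $$ (i, j))" if "Suc q \<le> i" "i < n" "i < Suc q + l" for i
      unfolding cS using that by (intro tF') auto
    fix i j assume ij: "Suc q + l \<le> i" "i < n" "Suc q \<le> j" "j < n"
    \<comment> \<open>Rows from \<open>Suc q + l\<close> on are exactly those beyond
      \<open>q + l\<close>, where y = U v; so the rank-one update is again \<open>U\<close> times a
      matrix and can be absorbed into \<phi>.\<close>
    have "F' $$ (i, j) = A $$ (i, j) + (\<Sum>s<r. U $$ (i, s) * \<phi> s j)
        - hh_tau y * (\<Sum>s<r. U $$ (i, s) * v s) * z j"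
      using new[of i j] low[of i j] v[of i] ij by simp
    then show "F' $$ (i, j) = A $$ (i, j)
        + (\<Sum>s<r. U $$ (i, s) * (\<phi> s j - hh_tau y * v s * z j))"
      by (simp add: algebra_simps sum_subtractf sum_distrib_left)
  qed
  ultimately show ?thesis
    unfolding F'_def[symmetric] bpsf_iff[OF less_imp_le[OF q] F'] by blast
qed

end

theorem lemma4:
  fixes n r p l m k :: nat and A B U V W S :: "real mat"
  assumes "bps_rep n r p l m A B U V W S"
    and "1 \<le> k" and "k \<le> n - 1"
    and "partial_factor A (k - 1) \<in> bpsf n r p l m U S A (k - 1)"
  shows "partial_factor A k \<in> bpsf n r p l m U S A k"
proof -
  interpret bps n r p l m A B U V W S by standard (rule assms(1))
  show ?thesis using bpsf_Suc[of "k - 1"] assms(2-4) by simp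
qed

end
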